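(* Let $\mathcal{H}$ be a Hilbert space, let $T:\mathcal{H}\to\mathcal{H}$ be a nonexpansive operator, let $z^\ast$ be a fixed point of $T$, let $(\lambda_j)_{j\ge 0}\subseteq(0,1]$ be a sequence of positive numbers, let $\tau_k:=\lambda_k(1-\lambda_k)$, and let $z^0\in\mathcal{H}$. Suppose that $(z^j)_{j\ge 0}\subseteq\mathcal{H}$ is generated by $$z^{k+1}=T_{\lambda_k}(z^k)\qquad (k\ge 0).$$ Then: 1. $\|z^k-z^\ast\|^2$ is monotonically nonincreasing in $k$. 2. $\|Tz^k-z^k\|^2$ is monotonically nonincreasing in $k$. 3. $\tau_k\|Tz^k-z^k\|^2$ is summable: $\sum_{i=0}^\infty\tau_i\|Tz^i-z^i\|^2\le\|z^0-z^\ast\|^2$. 4. If $\tau_k>0$ for all $k\ge0$, then $$\|Tz^k-z^k\|^2\le\frac{\|z^0-z^\ast\|^2}{\sum_{i=0}^k\tau_i}\quad\text{and}\quad \|Tz^k-z^k\|^2=o\left(\frac{1}{\sum_{i=\lceil k/2\rceil+1}^k\tau_i}\right).$$ In particular, if $(\tau_j)_{j\ge0}\subseteq(\varepsilon,\infty)$ for some $\varepsilon>0$, then $\|Tz^k-z^k\|^2=o(1/(k+1))$. 5. Suppose that, instead of the iteration above, $(z^j)_{j\ge0}$ is generated by $$z^{k+1}:=T_{\lambda_k}(z^k)+\lambda_ke^k\qquad(k\ge0)$$ for an error sequence $(e^j)_{j\ge0}\subseteq\mathcal{H}$ satisfying $\sum_{i=0}^\infty\lambda_i\|e^i\|<\infty$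 and $\sum_{i=0}^\infty(i+1)\lambda_i^2\|e^i\|^2<\infty$. (These two bounds hold, for example, when $\lambda_k\|e^k\|\le\omega_k$ for all $k\ge0$, for a sequence $(\omega_j)_{j\ge0}$ that is nonnegative, summable, and monotonically nonincreasing.) Then, if $(\tau_j)_{j\ge0}\subseteq(\varepsilon,\infty)$ for some $\varepsilon>0$, we continue to have $\|Tz^k-z^k\|^2=o(1/(k+1))$.
   Context: For a nonexpansive ($1$-Lipschitz) operator $T:\mathcal{H}\to\mathcal{H}$ and $\lambda\in(0,1]$, $T_\lambda:=(1-\lambda)I_{\mathcal{H}}+\lambda T$, where $I_{\mathcal{H}}$ is the identity. For nonnegative sequences, $a_k=o(1/c_k)$ means $c_ka_k\to0$ as $k\to\infty$. *)

theory Defs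
  imports "HOL-Analysis.Analysis"
begin

definition averaged :: "('a::real_vector \<Rightarrow> 'a) \<Rightarrow> real \<Rightarrow> 'a \<Rightarrow> 'a" where
  "averaged T l x = (1 - l) *\<^sub>R x + l *\<^sub>R T x"

text \<open>For nonnegative sequences, \<open>a k = o(1 / c k)\<close> means \<open>c k * a k \<longlonglongrightarrow> 0\<close>. This form
  needs no convention for the indices at which \<open>c k = 0\<close>.\<close>

definition little_o_recip :: "(nat \<Rightarrow> real) \<Rightarrow> (nat \<Rightarrow> real) \<Rightarrow> bool" where
  "little_o_recip a c \<longleftrightarrow> (\<lambda>k. c k * a k) \<longlonglongrightarrow> 0"

end

theory Submission
  imports Defs
begin

text \<open>Write \<open>p\<^sub>k = T z\<^sub>k - z\<^sub>k\<close> and \<open>d\<^sub>k = z\<^sub>k - z\<^sup>*\<close>. Strong convexity of the squared norm turns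
  nonexpansiveness into \<open>\<parallel>d\<^sub>k\<^sub>+\<^sub>1\<parallel>\<^sup>2 \<le> \<parallel>d\<^sub>k\<parallel>\<^sup>2 - \<tau>\<^sub>k \<parallel>p\<^sub>k\<parallel>\<^sup>2\<close> up to a summable error, so
  \<open>\<tau>\<^sub>k \<parallel>p\<^sub>k\<parallel>\<^sup>2\<close> is summable. Expanding \<open>\<parallel>T z\<^sub>k\<^sub>+\<^sub>1 - T z\<^sub>k\<parallel>\<^sup>2 \<le> \<parallel>z\<^sub>k\<^sub>+\<^sub>1 - z\<^sub>k\<parallel>\<^sup>2\<close> gives
  \<open>\<parallel>p\<^sub>k\<^sub>+\<^sub>1\<parallel>\<^sup>2 \<le> \<parallel>p\<^sub>k\<parallel>\<^sup>2 + \<lambda>\<^sub>k\<^sup>2 \<parallel>e\<^sub>k\<parallel>\<^sup>2 / \<tau>\<^sub>k\<close>. A summable sequence \<open>a\<close> with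
  \<open>a\<^sub>k\<^sub>+\<^sub>1 \<le> a\<^sub>k + b\<^sub>k\<close> and \<open>(k + 1) b\<^sub>k\<close> summable satisfies \<open>(k + 1) a\<^sub>k \<longlonglongrightarrow> 0\<close>: the
  sequence \<open>(k + 1) a\<^sub>k\<close> is quasi-decreasing, hence convergent, and a positive limit would
  contradict the divergence of the harmonic series.\<close>

section \<open>Real sequences\<close>

text \<open>Telescoping the descent bounds every partial sum of \<open>p\<close> by
  \<open>v 0\<close> plus the total of \<open>s\<close>, because the leftover \<open>v n\<close> is
  nonnegative.\<close>

lemma summable_of_quasi_descent:
  fixes v p s :: "nat \<Rightarrow> real"
  assumes v: "\<And>k. 0 \<le> v k" and p: "\<And>k. 0 \<le> p k" and s: "\<And>k. 0 \<le> s k" "summable s"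
    and descent: "\<And>k. v (Suc k) \<le> v k - p k + s k"
  shows "summable p" and "(\<Sum>k. p k) \<le> v 0 + (\<Sum>k. s k)"
proof -
  have partial: "(\<Sum>i<n. p i) \<le> v 0 - v n + (\<Sum>i<n. s i)" for n
  proof (induction n)
    case (Suc n)
    then show ?case using descent[of n] by simp
  qed simp
  have bound: "(\<Sum>i<n. p i) \<le> v 0 + (\<Sum>k. s k)" for n
  proof -
    have "(\<Sum>i<n. s i) \<le> (\<Sum>k. s k)"
      using s by (intro sum_le_suminf) auto
    then show ?thesis using partial[of n] v[of n] by linarith
  qed
  show "summable p"
    using p bound by (rule summableI_nonneg_bounded)
  then show "(\<Sum>k. p k) \<le> v 0 + (\<Sum>k. s k)"
    using bound by (rule suminf_le_const)
qed

text \<open>Subtracting the partial sums of \<open>s\<close> turns \<open>u\<close> into a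
  decreasing sequence that is bounded below; adding the convergent partial sums back preserves
  convergence.\<close>

lemma convergent_of_quasi_decreasing:
  fixes u s :: "nat \<Rightarrow> real"
  assumes u: "\<And>k. 0 \<le> u k" and s: "\<And>k. 0 \<le> s k" "summable s"
    and quasi_decreasing: "\<And>k. u (Suc k) \<le> u k + s k"
  shows "convergent u"
proof -
  define w where "w n = u n - (\<Sum>i<n. s i)" for n
  have "decseq w"
    using quasi_decreasing by (intro decseq_SucI) (simp add: w_def algebra_simps)
  moreover have "- (\<Sum>k. s k) \<le> w n" for n
    using u[of n] sum_le_suminf[OF s(2), of "{..<n}"] s(1) by (simp add: w_def)
  ultimately obtain L where "w \<longlonglongrightarrow> L"
    using decseq_convergent by blast
  then have "(\<lambda>n. w n + (\<Sum>i<n. s i)) \<longlonglongrightarrow> L + (\<Sum>k. s k)"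
    using s(2) by (intro tendsto_add summable_LIMSEQ)
  then show ?thesis
    by (auto simp: w_def convergent_def)
qed

lemma tendsto_Suc_times_of_summable:
  fixes a b :: "nat \<Rightarrow> real"
  assumes a: "\<And>k. 0 \<le> a k" "summable a"
    and b: "\<And>k. 0 \<le> b k" "summable (\<lambda>k. real (k + 1) * b k)"
    and quasi_decreasing: "\<And>k. a (Suc k) \<le> a k + b k"
  shows "(\<lambda>k. real (k + 1) * a k) \<longlonglongrightarrow> 0"
proof -
  let ?u = "\<lambda>k. real (k + 1) * a k"
  \<comment> \<open>The extra \<open>a (Suc k)\<close> pays for the growth of the weight from
    \<open>k + 1\<close> to \<open>k + 2\<close>.\<close>
  let ?s = "\<lambda>k. a (Suc k) + real (k + 1) * b k"
  have "?u (Suc k) \<le> ?u k + ?s k" for k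
    using mult_left_mono[OF quasi_decreasing[of k], of "real (k + 1)"]
    by (simp add: algebra_simps)
  moreover have "summable ?s"
    using a(2) b(2) by (intro summable_add) (auto simp: summable_Suc_iff)
  ultimately have "convergent ?u"
    using a(1) b(1) by (intro convergent_of_quasi_decreasing[of ?u ?s]) auto
  then obtain L where L: "?u \<longlonglongrightarrow> L"
    by (auto simp: convergent_def)
  have "0 \<le> L"
    using L a(1) by (intro LIMSEQ_le_const[OF L]) auto
  moreover have "\<not> 0 < L"
  proof
    assume "0 < L"
    then have "\<forall>\<^sub>F k in sequentially. L / 2 < ?u k"
      by (intro order_tendstoD(1)[OF L]) simp
    \<comment> \<open>If \<open>?u k\<close> stays above \<open>L / 2\<close>, the harmonic terms
      are dominated by a multiple of the summable \<open>a\<close>.\<close>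
    then have "\<forall>\<^sub>F k in sequentially. norm (inverse (real (Suc k))) \<le> 2 / L * a k"
    proof eventually_elim
      case (elim k)
      then show ?case using \<open>0 < L\<close> by (simp add: field_simps)
    qed
    then have "summable (\<lambda>k. inverse (real (Suc k)))"
      by (rule summable_comparison_test_ev) (intro summable_mult a(2))
    then show False
      using not_summable_harmonic[where 'a = real] summable_Suc_iff[of "\<lambda>k. inverse (real k)"]
      by simp
  qed
  ultimately show ?thesis using L by simp
qed

text \<open>By monotonicity \<open>(i + 1) * \<omega> i\<close> is at most the sum of the first
  \<open>i + 1\<close> terms, hence at most the whole series. One factor of the square thus absorbs
  the weight, and a multiple of \<open>\<omega> i\<close> remains.\<close>

lemma decseq_summable_weighted_squares:
  fixes \<omega> :: "nat \<Rightarrow> real"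
  assumes nonneg: "\<And>k. 0 \<le> \<omega> k" and "summable \<omega>" and "decseq \<omega>"
  shows "summable (\<lambda>i. real (i + 1) * (\<omega> i)\<^sup>2)"
proof (rule summable_comparison_test')
  show "summable (\<lambda>i. (\<Sum>k. \<omega> k) * \<omega> i)"
    using assms(2) by (rule summable_mult)
  fix i :: nat
  have "real (i + 1) * \<omega> i = (\<Sum>j\<le>i. \<omega> i)" by simp
  also have "\<dots> \<le> (\<Sum>j\<le>i. \<omega> j)"
    using assms(3) by (intro sum_mono) (auto simp: decseq_def)
  also have "\<dots> \<le> (\<Sum>k. \<omega> k)"
    using assms by (intro sum_le_suminf) auto
  finally have "(real (i + 1) * \<omega> i) * \<omega> i \<le> (\<Sum>k. \<omega> k) * \<omega> i"
    using nonneg by (intro mult_right_mono)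
  then show "norm (real (i + 1) * (\<omega> i)\<^sup>2) \<le> (\<Sum>k. \<omega> k) * \<omega> i"
    using nonneg[of i] by (simp add: power2_eq_square mult.assoc)
qed

text \<open>On the block up to \<open>k\<close> the value \<open>a k\<close> is the smallest, so the
  product is at most the block sum of \<open>c i * a i\<close>. This is bounded by the tail of a
  convergent series starting at \<open>m k\<close>.\<close>

lemma decseq_times_tail_sum_tendsto_0:
  fixes a c :: "nat \<Rightarrow> real" and m :: "nat \<Rightarrow> nat"
  assumes "decseq a" and a: "\<And>k. 0 \<le> a k" and c: "\<And>k. 0 \<le> c k"
    and summable: "summable (\<lambda>i. c i * a i)" and m: "filterlim m at_top sequentially"
  shows "(\<lambda>k. (\<Sum>i=m k..k. c i) * a k) \<longlonglongrightarrow> 0"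
proof (rule tendsto_sandwich)
  let ?S = "\<Sum>i. c i * a i"
  show "\<forall>\<^sub>F k in sequentially. 0 \<le> (\<Sum>i=m k..k. c i) * a k"
    using a c by (intro always_eventually allI mult_nonneg_nonneg sum_nonneg)
  show "\<forall>\<^sub>F k in sequentially. (\<Sum>i=m k..k. c i) * a k \<le> ?S - (\<Sum>i<m k. c i * a i)"
  proof (intro always_eventually allI)
    fix k
    have "(\<Sum>i=m k..k. c i) * a k \<le> (\<Sum>i=m k..k. c i * a i)"
      unfolding sum_distrib_right
      using assms(1) c by (intro sum_mono mult_left_mono) (auto simp: decseq_def)
    \<comment> \<open>For \<open>m k > k\<close> the block is empty and the union is just
      \<open>{..<m k}\<close>, so the comparison is with the full series rather than with a partial
      sum up to \<open>k\<close>.\<close>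
    also have "\<dots> + (\<Sum>i<m k. c i * a i) = (\<Sum>i\<in>{m k..k} \<union> {..<m k}. c i * a i)"
      by (intro sum.union_disjoint[symmetric]) auto
    also have "\<dots> \<le> ?S"
      using summable a c by (intro sum_le_suminf) auto
    finally show "(\<Sum>i=m k..k. c i) * a k \<le> ?S - (\<Sum>i<m k. c i * a i)" by simp
  qed
  have "(\<lambda>k. \<Sum>i<m k. c i * a i) \<longlonglongrightarrow> ?S"
    using filterlim_compose[OF summable_LIMSEQ[OF summable] m] .
  then show "(\<lambda>k. ?S - (\<Sum>i<m k. c i * a i)) \<longlonglongrightarrow> 0"
    using tendsto_diff[OF tendsto_const, of _ ?S sequentially ?S] by simp
qed simp

section \<open>Averaged nonexpansive operators\<close>

lemma nonexpansive_norm_le: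
  fixes T :: "'a::real_normed_vector \<Rightarrow> 'a"
  assumes "1-lipschitz_on UNIV T"
  shows "norm (T x - T y) \<le> norm (x - y)"
  using lipschitz_onD[OF assms, of x y] by (simp add: dist_norm)

text \<open>The exact form of strong convexity; its defect term is the source of the weights
  \<open>\<tau>\<close>.\<close>

lemma norm_convex_comb_squared:
  fixes x y :: "'a::real_inner"
  shows "(norm ((1 - l) *\<^sub>R x + l *\<^sub>R y))\<^sup>2
    = (1 - l) * (norm x)\<^sup>2 + l * (norm y)\<^sup>2 - l * (1 - l) * (norm (y - x))\<^sup>2"
  unfolding power2_norm_eq_inner
  by (simp add: inner_commute algebra_simps)

lemma averaged_distance_descent:
  fixes T :: "'a::real_inner \<Rightarrow> 'a"
  assumes "1-lipschitz_on UNIV T" and "T w = w" and "0 \<le> l"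
  shows "(norm (averaged T l x - w))\<^sup>2
    \<le> (norm (x - w))\<^sup>2 - l * (1 - l) * (norm (T x - x))\<^sup>2"
proof -
  have "averaged T l x - w = (1 - l) *\<^sub>R (x - w) + l *\<^sub>R (T x - w)"
    by (simp add: averaged_def algebra_simps)
  then have "(norm (averaged T l x - w))\<^sup>2 = (1 - l) * (norm (x - w))\<^sup>2
      + l * (norm (T x - w))\<^sup>2 - l * (1 - l) * (norm (T x - x))\<^sup>2"
    using norm_convex_comb_squared[of l "x - w" "T x - w"] by simp
  moreover have "l * (norm (T x - w))\<^sup>2 \<le> l * (norm (x - w))\<^sup>2"
    using nonexpansive_norm_le[OF assms(1), of x w] assms(2,3)
    by (intro mult_left_mono power_mono) auto
  ultimately show ?thesis by (simp add: algebra_simps)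
qed

text \<open>With \<open>p\<close> the old residual and \<open>r\<close> its change,
  \<open>y - x = l (p + e)\<close> and \<open>T y - T x = r + l (p + e)\<close>. Nonexpansiveness
  then cancels the common square and bounds the cross term \<open>inner r p\<close>, the only
  uncontrolled term in the expansion of \<open>norm (p + r)\<close> squared.\<close>

lemma perturbed_residual_descent:
  fixes T :: "'a::real_inner \<Rightarrow> 'a"
  assumes "1-lipschitz_on UNIV T" and "0 < l"
    and y: "y = averaged T l x + l *\<^sub>R e"
  shows "l * (norm (T y - y))\<^sup>2 \<le> l * (norm (T x - x))\<^sup>2
    - (1 - l) * (norm ((T y - y) - (T x - x)))\<^sup>2 - 2 * l * inner ((T y - y) - (T x - x)) e"
proof -
  define p r where "p = T x - x" and "r = (T y - y) - p"
  have step: "y - x = l *\<^sub>R (p + e)"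
    by (simp add: y p_def averaged_def algebra_simps)
  have "T y - T x = r + (y - x)"
    by (simp add: r_def p_def)
  then have "(norm (r + l *\<^sub>R (p + e)))\<^sup>2 \<le> (norm (l *\<^sub>R (p + e)))\<^sup>2"
    using nonexpansive_norm_le[OF assms(1), of y x] step by (intro power_mono) auto
  then have "(norm r)\<^sup>2 + 2 * l * inner r p + 2 * l * inner r e \<le> 0"
    unfolding power2_norm_eq_inner
    by (simp add: inner_commute algebra_simps)
  moreover have "T y - y = p + r" by (simp add: r_def)
  moreover have "l * (norm (p + r))\<^sup>2 = l * (norm p)\<^sup>2 + 2 * l * inner r p + l * (norm r)\<^sup>2"
    unfolding power2_norm_eq_inner
    by (simp add: inner_commute algebra_simps)
  ultimately show ?thesis
    by (simp flip: p_def add: algebra_simps)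
qed

lemma averaged_residual_le:
  fixes T :: "'a::real_inner \<Rightarrow> 'a"
  assumes "1-lipschitz_on UNIV T" and "0 < l" and "l \<le> 1"
  shows "(norm (T (averaged T l x) - averaged T l x))\<^sup>2 \<le> (norm (T x - x))\<^sup>2"
proof -
  let ?y = "averaged T l x"
  have "0 \<le> (1 - l) * (norm ((T ?y - ?y) - (T x - x)))\<^sup>2"
    using assms(3) by simp
  then have "l * (norm (T ?y - ?y))\<^sup>2 \<le> l * (norm (T x - x))\<^sup>2"
    using perturbed_residual_descent[OF assms(1,2), of ?y x 0] by simp
  then show ?thesis using assms(2) by simp
qed

text \<open>The inner product with the error has no sign; completing a square absorbs it into the
  negative multiple of \<open>(norm r)\<^sup>2\<close>. The lower bound \<open>\<epsilon>\<close>
  then replaces the step-dependent divisor \<open>l * (1 - l)\<close>.\<close>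

lemma perturbed_residual_le:
  fixes T :: "'a::real_inner \<Rightarrow> 'a"
  assumes "1-lipschitz_on UNIV T" and "0 < l" and "0 < \<epsilon>" and "\<epsilon> < l * (1 - l)"
    and y: "y = averaged T l x + l *\<^sub>R e"
  shows "(norm (T y - y))\<^sup>2 \<le> (norm (T x - x))\<^sup>2 + l\<^sup>2 * (norm e)\<^sup>2 / \<epsilon>"
proof -
  define r where "r = (T y - y) - (T x - x)"
  have pos: "0 < l * (1 - l)" using assms by simp
  then have "0 < 1 - l" using assms(2) by (simp add: zero_less_mult_iff)
  \<comment> \<open>The coefficients are those for which the cross term matches the inner product in
    the descent inequality multiplied by \<open>1 - l\<close>.\<close>
  have "0 \<le> (norm ((1 - l) *\<^sub>R r + l *\<^sub>R e))\<^sup>2" by simp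
  also have "\<dots> = (1 - l)\<^sup>2 * (norm r)\<^sup>2 + 2 * l * (1 - l) * inner r e + l\<^sup>2 * (norm e)\<^sup>2"
    unfolding power2_norm_eq_inner
    by (simp add: inner_commute power2_eq_square algebra_simps)
  finally have "(1 - l) * (- (1 - l) * (norm r)\<^sup>2 - 2 * l * inner r e) \<le> l\<^sup>2 * (norm e)\<^sup>2"
    by (simp add: power2_eq_square algebra_simps)
  moreover have "(1 - l) * (l * (norm (T y - y))\<^sup>2)
      \<le> (1 - l) * (l * (norm (T x - x))\<^sup>2 - (1 - l) * (norm r)\<^sup>2 - 2 * l * inner r e)"
    using perturbed_residual_descent[OF assms(1,2) y] \<open>0 < 1 - l\<close>
    unfolding r_def by (intro mult_left_mono) auto
  ultimately have "l * (1 - l) * (norm (T y - y))\<^sup>2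
      \<le> l * (1 - l) * (norm (T x - x))\<^sup>2 + l\<^sup>2 * (norm e)\<^sup>2"
    by (simp add: algebra_simps)
  then have "((norm (T y - y))\<^sup>2 - (norm (T x - x))\<^sup>2) * (l * (1 - l)) \<le> l\<^sup>2 * (norm e)\<^sup>2"
    by (simp add: algebra_simps)
  then have "(norm (T y - y))\<^sup>2 \<le> (norm (T x - x))\<^sup>2 + l\<^sup>2 * (norm e)\<^sup>2 / (l * (1 - l))"
    unfolding pos_le_divide_eq[OF pos, symmetric] by simp
  also have "l\<^sup>2 * (norm e)\<^sup>2 / (l * (1 - l)) \<le> l\<^sup>2 * (norm e)\<^sup>2 / \<epsilon>"
    using assms(3,4) by (intro divide_left_mono) auto
  finally show ?thesis by simp
qed

section \<open>The perturbed iteration\<close>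

text \<open>The argument runs twice: unsquared distances are quasi-decreasing by the triangle
  inequality, hence bounded; with this bound the error terms created by squaring become
  summable.\<close>

lemma perturbed_iteration_summable:
  fixes T :: "'a::real_inner \<Rightarrow> 'a" and z e :: "nat \<Rightarrow> 'a" and lam :: "nat \<Rightarrow> real"
  assumes "1-lipschitz_on UNIV T" and "T w = w" and lam: "\<And>k. 0 < lam k \<and> lam k \<le> 1"
    and z: "\<And>k. z (Suc k) = averaged T (lam k) (z k) + lam k *\<^sub>R e k"
    and e: "summable (\<lambda>i. lam i * norm (e i))"
  shows "summable (\<lambda>i. lam i * (1 - lam i) * (norm (T (z i) - z i))\<^sup>2)"
proof -
  define d where "d k = norm (z k - w)" for k
  define c where "c k = norm (averaged T (lam k) (z k) - w)" for k
  define \<eta> where "\<eta> k = lam k * norm (e k)" for k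
  let ?p = "\<lambda>i. lam i * (1 - lam i) * (norm (T (z i) - z i))\<^sup>2"
  have \<eta>: "0 \<le> \<eta> k" "summable \<eta>" for k
    using lam[of k] e unfolding \<eta>_def by auto
  have p: "0 \<le> ?p k" for k
    using lam[of k] by simp
  have cd: "(c k)\<^sup>2 \<le> (d k)\<^sup>2 - ?p k" for k
    unfolding c_def d_def using lam[of k] by (intro averaged_distance_descent assms(1,2)) simp
  have le: "c k \<le> d k" for k
  proof (rule power2_le_imp_le)
    show "(c k)\<^sup>2 \<le> (d k)\<^sup>2" using cd[of k] p[of k] by linarith
  qed (simp add: d_def)
  have step: "d (Suc k) \<le> c k + \<eta> k" for k
  proof -
    have "d (Suc k) = norm ((averaged T (lam k) (z k) - w) + lam k *\<^sub>R e k)"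
      by (simp add: d_def z algebra_simps)
    also have "\<dots> \<le> c k + norm (lam k *\<^sub>R e k)"
      unfolding c_def by (rule norm_triangle_ineq)
    finally show ?thesis using lam[of k] by (simp add: \<eta>_def)
  qed
  have "convergent d"
  proof (rule convergent_of_quasi_decreasing[of d \<eta>])
    show "d (Suc k) \<le> d k + \<eta> k" for k
      using step[of k] le[of k] by simp
  qed (auto simp: d_def \<eta>)
  then obtain M where M: "\<And>k. d k \<le> M"
    using convergent_imp_Bseq[of d] by (auto simp: Bseq_def abs_le_iff)
  have "convergent \<eta>"
    using summable_LIMSEQ_zero[OF \<eta>(2)] by (auto simp: convergent_def)
  then obtain N where N: "\<And>k. \<eta> k \<le> N"
    using convergent_imp_Bseq[of \<eta>] by (auto simp: Bseq_def abs_le_iff)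
  have "0 \<le> d 0" by (simp add: d_def)
  then have nonneg: "0 \<le> M" "0 \<le> N" using M[of 0] N[of 0] \<eta>(1)[of 0] by auto
  show ?thesis
  \<comment> \<open>The constant bounds \<open>2 * c k + \<eta> k\<close>, the cofactor of
    \<open>\<eta> k\<close> in the expanded square, since \<open>c k \<le> d k \<le> M\<close> and
    \<open>\<eta> k \<le> N\<close>.\<close>
  proof (rule summable_of_quasi_descent(1)[of "\<lambda>k. (d k)\<^sup>2" ?p "\<lambda>k. (2 * M + N) * \<eta> k"])
    fix k
    have "(d (Suc k))\<^sup>2 \<le> (c k + \<eta> k)\<^sup>2"
      using step[of k] by (intro power_mono) (auto simp: d_def)
    also have "\<dots> = (c k)\<^sup>2 + (2 * c k + \<eta> k) * \<eta> k"
      by (simp add: power2_eq_square algebra_simps)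
    also have "\<dots> \<le> (d k)\<^sup>2 - ?p k + (2 * M + N) * \<eta> k"
      using cd[of k] M[of k] N[of k] le[of k] \<eta>(1)[of k]
      by (intro add_mono mult_right_mono) auto
    finally show "(d (Suc k))\<^sup>2 \<le> (d k)\<^sup>2 - ?p k + (2 * M + N) * \<eta> k" .
    show "0 \<le> (2 * M + N) * \<eta> k"
      using nonneg \<eta>(1) by simp
    show "summable (\<lambda>k. (2 * M + N) * \<eta> k)"
      using \<eta>(2) by (rule summable_mult)
  qed (simp, rule p)
qed

text \<open>The bound \<open>\<epsilon>\<close> removes the weights from the summable series of
  residuals, and the second error condition is the weighted summability required of the increments
  \<open>b\<close>.\<close>

lemma perturbed_iteration_rate:
  fixes T :: "'a::real_inner \<Rightarrow> 'a" and z e :: "nat \<Rightarrow> 'a" and lam :: "nat \<Rightarrow> real"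
  assumes "1-lipschitz_on UNIV T" and "T w = w" and lam: "\<And>k. 0 < lam k \<and> lam k \<le> 1"
    and z: "\<And>k. z (Suc k) = averaged T (lam k) (z k) + lam k *\<^sub>R e k"
    and e: "summable (\<lambda>i. lam i * norm (e i))"
      "summable (\<lambda>i. real (i + 1) * (lam i)\<^sup>2 * (norm (e i))\<^sup>2)"
    and \<epsilon>: "0 < \<epsilon>" "\<And>k. \<epsilon> < lam k * (1 - lam k)"
  shows "little_o_recip (\<lambda>k. (norm (T (z k) - z k))\<^sup>2) (\<lambda>k. real (k + 1))"
  unfolding little_o_recip_def
proof (rule tendsto_Suc_times_of_summable)
  show "summable (\<lambda>k. (norm (T (z k) - z k))\<^sup>2)"
  proof (rule summable_comparison_test')
    show "summable (\<lambda>i. lam i * (1 - lam i) * (norm (T (z i) - z i))\<^sup>2 / \<epsilon>)"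
      by (intro summable_divide perturbed_iteration_summable[of T w lam z e] assms)
    fix k :: nat
    show "norm ((norm (T (z k) - z k))\<^sup>2) \<le> lam k * (1 - lam k) * (norm (T (z k) - z k))\<^sup>2 / \<epsilon>"
      using mult_right_mono[OF less_imp_le[OF \<epsilon>(2)[of k]], of "(norm (T (z k) - z k))\<^sup>2"] \<epsilon>(1)
      by (simp add: field_simps)
  qed
  show "summable (\<lambda>k. real (k + 1) * ((lam k)\<^sup>2 * (norm (e k))\<^sup>2 / \<epsilon>))"
    using summable_divide[OF e(2), of \<epsilon>] by (simp add: mult.assoc)
  show "(norm (T (z (Suc k)) - z (Suc k)))\<^sup>2
      \<le> (norm (T (z k) - z k))\<^sup>2 + (lam k)\<^sup>2 * (norm (e k))\<^sup>2 / \<epsilon>" for k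
    using perturbed_residual_le[OF assms(1) _ \<epsilon>(1) \<epsilon>(2) z] lam[of k] by simp
qed (use \<epsilon>(1) in auto)

theorem theorem1:
  fixes T :: "'a::{real_inner, complete_space} \<Rightarrow> 'a"
    and zfix z0 :: 'a
    and lam tau :: "nat \<Rightarrow> real"
  assumes nonexpansive: "1-lipschitz_on UNIV T"
    and fixed_point: "T zfix = zfix"
    and lam_range: "\<And>j. 0 < lam j \<and> lam j \<le> 1"
    and tau_eq: "\<And>k. tau k = lam k * (1 - lam k)"
  shows
    "(\<forall>z :: nat \<Rightarrow> 'a. z 0 = z0 \<and> (\<forall>k. z (Suc k) = averaged T (lam k) (z k)) \<longrightarrow>
        decseq (\<lambda>k. (norm (z k - zfix))\<^sup>2)
      \<and> decseq (\<lambda>k. (norm (T (z k) - z k))\<^sup>2)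
      \<and> (summable (\<lambda>i. tau i * (norm (T (z i) - z i))\<^sup>2)
          \<and> (\<Sum>i. tau i * (norm (T (z i) - z i))\<^sup>2) \<le> (norm (z0 - zfix))\<^sup>2)
      \<and> ((\<forall>k. tau k > 0) \<longrightarrow>
            (\<forall>k. (norm (T (z k) - z k))\<^sup>2 \<le> (norm (z0 - zfix))\<^sup>2 / (\<Sum>i=0..k. tau i))
          \<and> little_o_recip (\<lambda>k. (norm (T (z k) - z k))\<^sup>2)
              (\<lambda>k. \<Sum>i = nat \<lceil>real k / 2\<rceil> + 1..k. tau i))
      \<and> ((\<exists>\<epsilon>>0. \<forall>j. tau j > \<epsilon>) \<longrightarrow>
            little_o_recip (\<lambda>k. (norm (T (z k) - z k))\<^sup>2) (\<lambda>k. real (k + 1))))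
   \<and> (\<forall>(z :: nat \<Rightarrow> 'a) (e :: nat \<Rightarrow> 'a).
        z 0 = z0 \<and> (\<forall>k. z (Suc k) = averaged T (lam k) (z k) + lam k *\<^sub>R e k)
      \<and> summable (\<lambda>i. lam i * norm (e i))
      \<and> summable (\<lambda>i. real (i + 1) * (lam i)\<^sup>2 * (norm (e i))\<^sup>2)
      \<and> (\<exists>\<epsilon>>0. \<forall>j. tau j > \<epsilon>) \<longrightarrow>
        little_o_recip (\<lambda>k. (norm (T (z k) - z k))\<^sup>2) (\<lambda>k. real (k + 1)))
   \<and> (\<forall>(e :: nat \<Rightarrow> 'a) (\<omega> :: nat \<Rightarrow> real).
        (\<forall>k. \<omega> k \<ge> 0) \<and> summable \<omega> \<and> decseq \<omega> \<and> (\<forall>k. lam k * norm (e k) \<le> \<omega> k) \<longrightarrow>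
        summable (\<lambda>i. lam i * norm (e i))
      \<and> summable (\<lambda>i. real (i + 1) * (lam i)\<^sup>2 * (norm (e i))\<^sup>2))"
proof (intro conjI, goal_cases exact perturbed admissible)
  have lam: "0 < lam j" "lam j \<le> 1" for j
    using lam_range by auto
  have tau_nonneg: "0 \<le> tau j" for j
    using lam[of j] by (simp add: tau_eq)
  {
    case exact
    show ?case
    proof (intro allI impI, elim conjE)
      fix z :: "nat \<Rightarrow> 'a"
      assume z0: "z 0 = z0" and z: "\<forall>k. z (Suc k) = averaged T (lam k) (z k)"
      let ?a = "\<lambda>k. (norm (T (z k) - z k))\<^sup>2"
      let ?d = "\<lambda>k. (norm (z k - zfix))\<^sup>2"
      \<comment> \<open>The trailing \<open>+ 0\<close> fits the quasi-descent pattern with zero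
        error.\<close>
      have descent: "?d (Suc k) \<le> ?d k - tau k * ?a k + 0" for k
        using averaged_distance_descent[OF nonexpansive fixed_point, of "lam k" "z k"] lam[of k] z
        by (simp add: tau_eq)
      have nonneg: "0 \<le> tau k * ?a k" for k
        using tau_nonneg[of k] by simp
      have dec_d: "decseq ?d"
      proof (rule decseq_SucI)
        show "?d (Suc k) \<le> ?d k" for k using descent[of k] nonneg[of k] by linarith
      qed
      have dec: "decseq ?a"
        using z averaged_residual_le[OF nonexpansive lam] by (intro decseq_SucI) simp
      note descent_sum = summable_of_quasi_descent[of ?d "\<lambda>k. tau k * ?a k" "\<lambda>_. 0"]
      have summ: "summable (\<lambda>i. tau i * ?a i)"
        by (rule descent_sum(1)) (use nonneg descent in auto)
      have "(\<Sum>i. tau i * ?a i) \<le> ?d 0 + (\<Sum>k::nat. 0)"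
        by (rule descent_sum(2)) (use nonneg descent in auto)
      then have le: "(\<Sum>i. tau i * ?a i) \<le> (norm (z0 - zfix))\<^sup>2"
        by (simp add: z0)
      have bound: "?a k \<le> (norm (z0 - zfix))\<^sup>2 / (\<Sum>i=0..k. tau i)" if pos: "\<forall>k. tau k > 0" for k
      proof -
        \<comment> \<open>The latest residual is the smallest so far, so replacing it by the earlier
          ones only increases the sum.\<close>
        have "?a k * (\<Sum>i=0..k. tau i) = (\<Sum>i=0..k. tau i * ?a k)"
          by (simp add: sum_distrib_right mult.commute[of "?a k"])
        also have "\<dots> \<le> (\<Sum>i=0..k. tau i * ?a i)"
          using dec tau_nonneg by (intro sum_mono mult_left_mono) (auto simp: decseq_def)
        also have "\<dots> \<le> (\<Sum>i. tau i * ?a i)"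
          using summ nonneg by (intro sum_le_suminf) auto
        also note le
        finally show ?thesis
          using pos by (simp add: pos_le_divide_eq sum_pos)
      qed
      \<comment> \<open>The block starts beyond \<open>k / 2\<close>, so its left end tends to
        infinity; for \<open>k = 0\<close> and \<open>k = 1\<close> it is empty.\<close>
      have "filterlim (\<lambda>k. nat \<lceil>real k / 2\<rceil> + 1) at_top sequentially"
        unfolding filterlim_at_top
      proof
        fix n :: nat
        show "\<forall>\<^sub>F k in sequentially. n \<le> nat \<lceil>real k / 2\<rceil> + 1"
          using eventually_ge_at_top[of "2 * n"] by eventually_elim linarith
      qed
      then have tail: "little_o_recip ?a (\<lambda>k. \<Sum>i = nat \<lceil>real k / 2\<rceil> + 1..k. tau i)"
        unfolding little_o_recip_def
        by (rule decseq_times_tail_sum_tendsto_0[OF dec _ tau_nonneg summ, rotated]) simp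
      have rate: "little_o_recip ?a (\<lambda>k. real (k + 1))" if "\<exists>\<epsilon>>0. \<forall>j. tau j > \<epsilon>"
      proof -
        from that obtain \<epsilon> where "0 < \<epsilon>" "\<And>k. \<epsilon> < lam k * (1 - lam k)"
          by (auto simp: tau_eq)
        then show ?thesis
          \<comment> \<open>The exact iteration is the perturbed one with zero errors, for which
            both summability conditions are trivial.\<close>
          using z by (intro perturbed_iteration_rate[where e = "\<lambda>_. 0" and lam = lam,
                OF nonexpansive fixed_point lam_range]) auto
      qed
      show "decseq ?d \<and> decseq ?a
        \<and> (summable (\<lambda>i. tau i * ?a i) \<and> (\<Sum>i. tau i * ?a i) \<le> (norm (z0 - zfix))\<^sup>2)
        \<and> ((\<forall>k. tau k > 0) \<longrightarrow> (\<forall>k. ?a k \<le> (norm (z0 - zfix))\<^sup>2 / (\<Sum>i=0..k. tau i))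
            \<and> little_o_recip ?a (\<lambda>k. \<Sum>i = nat \<lceil>real k / 2\<rceil> + 1..k. tau i))
        \<and> ((\<exists>\<epsilon>>0. \<forall>j. tau j > \<epsilon>) \<longrightarrow> little_o_recip ?a (\<lambda>k. real (k + 1)))"
        by (intro conjI impI allI dec_d dec summ le bound tail rate) auto
    qed
  next
    case perturbed
    show ?case
    proof (intro allI impI, elim conjE)
      fix z e :: "nat \<Rightarrow> 'a"
      assume z: "\<forall>k. z (Suc k) = averaged T (lam k) (z k) + lam k *\<^sub>R e k"
        and e: "summable (\<lambda>i. lam i * norm (e i))"
          "summable (\<lambda>i. real (i + 1) * (lam i)\<^sup>2 * (norm (e i))\<^sup>2)"
        and "\<exists>\<epsilon>>0. \<forall>j. tau j > \<epsilon>"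
      then obtain \<epsilon> where \<epsilon>: "0 < \<epsilon>" "\<And>k. \<epsilon> < lam k * (1 - lam k)"
        by (auto simp: tau_eq)
      show "little_o_recip (\<lambda>k. (norm (T (z k) - z k))\<^sup>2) (\<lambda>k. real (k + 1))"
        using perturbed_iteration_rate[OF nonexpansive fixed_point lam_range _ e \<epsilon>] z by blast
    qed
  next
    case admissible
    show ?case
    proof (intro allI impI, elim conjE)
      fix e :: "nat \<Rightarrow> 'a" and \<omega> :: "nat \<Rightarrow> real"
      assume \<omega>: "\<forall>k. \<omega> k \<ge> 0" "summable \<omega>" "decseq \<omega>" and le: "\<forall>k. lam k * norm (e k) \<le> \<omega> k"
      have nonneg: "0 \<le> lam k * norm (e k)" for k
        using lam[of k] by simp
      have "summable (\<lambda>i. lam i * norm (e i))"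
      proof (rule summable_comparison_test'[OF \<omega>(2)])
        show "norm (lam i * norm (e i)) \<le> \<omega> i" for i
          using nonneg[of i] le by simp
      qed
      moreover have "summable (\<lambda>i. real (i + 1) * (lam i)\<^sup>2 * (norm (e i))\<^sup>2)"
      proof (rule summable_comparison_test')
        show "summable (\<lambda>i. real (i + 1) * (\<omega> i)\<^sup>2)"
          using \<omega> by (intro decseq_summable_weighted_squares) auto
        fix i :: nat
        have "(lam i * norm (e i))\<^sup>2 \<le> (\<omega> i)\<^sup>2"
          using nonneg[of i] le by (intro power_mono) auto
        then have "real (i + 1) * (lam i * norm (e i))\<^sup>2 \<le> real (i + 1) * (\<omega> i)\<^sup>2"
          by (rule mult_left_mono) simp
        then show "norm (real (i + 1) * (lam i)\<^sup>2 * (norm (e i))\<^sup>2) \<le> real (i + 1) * (\<omega> i)\<^sup>2"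
          by (simp add: power_mult_distrib mult.assoc)
      qed
      ultimately show "summable (\<lambda>i. lam i * norm (e i))
          \<and> summable (\<lambda>i. real (i + 1) * (lam i)\<^sup>2 * (norm (e i))\<^sup>2)" ..
    qed
  }
qed

end
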